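(* Let $\Lambda$ be the set of ABDF configurations, $\mathcal P$ the pair operator, $\mathcal T_{\mathrm{ABDF}}$ and $\mathcal T_{\mathrm{TASEP}}$ the one-step ABDF and TASEP maps, and $\Omega=\{0,1\}^{\mathbb N\times\mathbb Z}$ (all defined in the context). Then: (a) The pair map $\mathcal P$ is a bijection between $\{0,1\}^{\mathbb Z}$ and $\Lambda$. (b) For every $\eta\in\{0,1\}^{\mathbb Z}$, $t\in\mathbb N$, $\omega\in\Omega$, $$\mathcal T_{\mathrm{ABDF}}(t,\omega,\mathcal P(\eta))=\mathcal P\big(\mathcal T_{\mathrm{TASEP}}(t,\omega,\eta)\big);$$ in particular, $\mathcal T_{\mathrm{ABDF}}(t,\omega,\Lambda)\subset\Lambda$.
   Context: Here $\mathbb N=\{0,1,2,\dots\}$. For $x\in\mathbb Z$ let $alt_0(x)=x \bmod 2$ and $alt_1(x)=(x+1)\bmod 2$ (values in $\{0,1\}$), and for $\alpha=0,1$ let $\overline{alt}_\alpha(x)=(0,alt_\alpha(x))$. **The set $\Lambda_0$.** $\Lambda_0$ is the set of sequences $\theta:\mathbb Z\to\{-1,0,1\}$, not identically zero, such that: (i) if $x_1<x_2$ are integers with $\theta(x_1)\theta(x_2)=-1$ and $\theta(x)=0$ for all $x\in(x_1,x_2)\cap\mathbb Z$, then the cardinality of $(x_1,x_2)\cap\mathbb Z$ is odd; (ii) if $x_1<x_2$ are integers with $\theta(x_1)\theta(x_2)=1$ and $\theta(x)=0$ for all $x\in(x_1,x_2)\cap\mathbb Z$, then the cardinality of $(x_1,x_2)\cap\mathbb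 Z$ is even. **Activation record.** For $\theta\in\Lambda_0$, $ar(\theta):\mathbb Z\to\{0,1\}$ is defined by: (iii) if $\theta(x_0)\in\{-1,1\}$, then $ar(\theta)(x_0)=0$; (iv) if $\theta(x_0)=0$ and $L(x_0)=\{x<x_0:\theta(x)\in\{-1,1\}\}\ne\emptyset$, let $x_1=\max L(x_0)$, $k=x_0-x_1$, and $ar(\theta)(x_0)=\left|\frac{\theta(x_1)+(-1)^k}{2}\right|$; (v) if $\theta(x_0)=0$ and $R(x_0)=\{x>x_0:\theta(x)\in\{-1,1\}\}\ne\emptyset$, let $x_2=\min R(x_0)$, $h=x_2-x_0$, and $ar(\theta)(x_0)=\left|\frac{\theta(x_2)+(-1)^{h+1}}{2}\right|$. For $\theta\in\Lambda_0$ rules (iv) and (v) agree when both apply. To have an a priori definition, $ar(\theta)$ is given by the same rules for any $\theta\neq0$, using (iv) whenever it applies. **ABDF configurations.** $\Lambda$ is the set of maps $(\theta,act):\mathbb Z\to\{-1,0,1\}\times\{0,1\}$ such that either $\theta=0$ and $act\in\{alt_0,alt_1\}$, or $\theta\in\Lambda_0$ and $act=ar(\theta)$. **Noise.** $\Omega=\{0,1\}^{\mathbb N\times\mathbb Z}$; $\omega(t,x)$ is the $(t,x)$-coordinate of $\omega$ and $\varkappa(t,x)=1-\omega(t,x)$. **ABDF map.** $\mathcal T_{\mathrm{ABDF}}(t,\omega,\cdot):\Lambda\to(\{-1,0,1\}\times\{0,1\})^{\mathbb Z}$ has components $\mathcal T_{\mathrm{ABDF}}(t,\omega,(\theta,act))_1$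 and $\mathcal T_{\mathrm{ABDF}}(t,\omega,(\theta,act))_2$. For $t=0$ it is the identity. For $t>0$, $$\mathcal T_{\mathrm{ABDF}}(t,\omega,(\theta,act))_1(x)=\max(\theta(x-1),0)+act(x-1)\varkappa(t-1,x-1)+\min(\theta(x+1),0)-act(x+1)\varkappa(t-1,x+1).$$ If this first component is not identically zero, the second component is $ar$ of the first component. If the first component is identically zero, the second component equals $alt_1$ if at least one of the following holds: $\theta(0)=-1$; or $act(-1)=1$ and $\omega(t-1,-1)=1$; or $act(0)=1$ and $\omega(t-1,0)=0$; otherwise it equals $alt_0$. **TASEP map.** For $\eta\in\{0,1\}^{\mathbb Z}$, $\mathcal T_{\mathrm{TASEP}}(0,\omega,\cdot)$ is the identity and for $t>0$ $$\mathcal T_{\mathrm{TASEP}}(t,\omega,\eta)(x)=[\varkappa(t-1,x)\eta(x)+\omega(t-1,x)\eta(x+1)]\,\eta(x)+[\varkappa(t-1,x-1)\eta(x)+\omega(t-1,x-1)\eta(x-1)]\,(1-\eta(x)).$$ **Pair operator.** $\mathcal P:\{0,1\}^{\mathbb Z}\to(\{-1,0,1\}\times\{0,1\})^{\mathbb Z}$, $\mathcal P(\eta)(x)=(\mathcal P(\eta)_1(x),\mathcal P(\eta)_2(x))$, where $\mathcal P(\eta)_1(x)=1-\eta(x)-\eta(x+1)$; if $\mathcal P(\eta)_1\ne0$ then $\mathcal P(\eta)_2=ar(\mathcal P(\eta)_1)$; if $\mathcal P(\eta)_1=0$ (i.e. $\eta=alt_\alpha$ for $\alpha=0$ or $1$)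 then $\mathcal P(\eta)_2=\eta$. *)

theory Defs
  imports Main "HOL-Library.FuncSet"
begin

(* All maps take integer values; their ranges are cut down by the carrier sets
   binary_seqs, ternary_seqs, noise and Lambda. *)

definition binary_seqs :: "(int \<Rightarrow> int) set" where
  "binary_seqs = (UNIV \<rightarrow> {0, 1})"

definition ternary_seqs :: "(int \<Rightarrow> int) set" where
  "ternary_seqs = (UNIV \<rightarrow> {-1, 0, 1})"

definition noise :: "(nat \<times> int \<Rightarrow> int) set" where
  "noise = (UNIV \<rightarrow> {0, 1})"

definition kappa :: "(nat \<times> int \<Rightarrow> int) \<Rightarrow> nat \<times> int \<Rightarrow> int" where
  "kappa \<omega> p = 1 - \<omega> p"

definition alt0 :: "int \<Rightarrow> int" where
  "alt0 x = x mod 2"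

definition alt1 :: "int \<Rightarrow> int" where
  "alt1 x = (x + 1) mod 2"

definition Lambda0 :: "(int \<Rightarrow> int) set" where
  "Lambda0 = {\<theta> \<in> ternary_seqs. \<theta> \<noteq> (\<lambda>x. 0) \<and>
     (\<forall>x1 x2. x1 < x2 \<and> \<theta> x1 * \<theta> x2 = -1 \<and> (\<forall>x\<in>{x1<..<x2}. \<theta> x = 0)
        \<longrightarrow> odd (card {x1<..<x2})) \<and>
     (\<forall>x1 x2. x1 < x2 \<and> \<theta> x1 * \<theta> x2 = 1 \<and> (\<forall>x\<in>{x1<..<x2}. \<theta> x = 0)
        \<longrightarrow> even (card {x1<..<x2}))}"

definition Lset :: "(int \<Rightarrow> int) \<Rightarrow> int \<Rightarrow> int set" where
  "Lset \<theta> x0 = {x. x < x0 \<and> \<theta> x \<in> {-1, 1}}"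

definition Rset :: "(int \<Rightarrow> int) \<Rightarrow> int \<Rightarrow> int set" where
  "Rset \<theta> x0 = {x. x > x0 \<and> \<theta> x \<in> {-1, 1}}"

(* Lset and Rset may be infinite, so their maximum and minimum are taken with
   GREATEST and LEAST rather than Max and Min.  The divisions by 2 are exact, since
   \<theta> is 1 or -1 at the chosen site.  The final 0 is a dummy value: it is reached
   only if \<theta> has no entry 1 or -1 at all. *)
definition ar :: "(int \<Rightarrow> int) \<Rightarrow> int \<Rightarrow> int" where
  "ar \<theta> x0 =
     (if \<theta> x0 \<in> {-1, 1} then 0
      else if Lset \<theta> x0 \<noteq> {} then
        (let x1 = (GREATEST x. x \<in> Lset \<theta> x0); k = nat (x0 - x1)
         in \<bar>(\<theta> x1 + (-1) ^ k) div 2\<bar>)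
      else if Rset \<theta> x0 \<noteq> {} then
        (let x2 = (LEAST x. x \<in> Rset \<theta> x0); h = nat (x2 - x0)
         in \<bar>(\<theta> x2 + (-1) ^ (h + 1)) div 2\<bar>)
      else 0)"

definition Lambda :: "(int \<Rightarrow> int \<times> int) set" where
  "Lambda = {c \<in> UNIV \<rightarrow> {-1, 0, 1} \<times> {0, 1}.
     (fst \<circ> c = (\<lambda>x. 0) \<and> snd \<circ> c \<in> {alt0, alt1}) \<or>
     (fst \<circ> c \<in> Lambda0 \<and> snd \<circ> c = ar (fst \<circ> c))}"

definition T_ABDF_1 ::
  "nat \<Rightarrow> (nat \<times> int \<Rightarrow> int) \<Rightarrow> (int \<Rightarrow> int \<times> int) \<Rightarrow> int \<Rightarrow> int" where
  "T_ABDF_1 t \<omega> c =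
     (let \<theta> = fst \<circ> c; act = snd \<circ> c in
      if t = 0 then \<theta>
      else (\<lambda>x. max (\<theta> (x - 1)) 0 + act (x - 1) * kappa \<omega> (t - 1, x - 1)
              + min (\<theta> (x + 1)) 0 - act (x + 1) * kappa \<omega> (t - 1, x + 1)))"

definition T_ABDF_2 ::
  "nat \<Rightarrow> (nat \<times> int \<Rightarrow> int) \<Rightarrow> (int \<Rightarrow> int \<times> int) \<Rightarrow> int \<Rightarrow> int" where
  "T_ABDF_2 t \<omega> c =
     (let \<theta> = fst \<circ> c; act = snd \<circ> c in
      if t = 0 then act
      else if T_ABDF_1 t \<omega> c \<noteq> (\<lambda>x. 0) then ar (T_ABDF_1 t \<omega> c)
      else if \<theta> 0 = -1 \<or> (act (-1) = 1 \<and> \<omega> (t - 1, -1) = 1)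
              \<or> (act 0 = 1 \<and> \<omega> (t - 1, 0) = 0)
           then alt1 else alt0)"

definition T_ABDF ::
  "nat \<Rightarrow> (nat \<times> int \<Rightarrow> int) \<Rightarrow> (int \<Rightarrow> int \<times> int) \<Rightarrow> int \<Rightarrow> int \<times> int" where
  "T_ABDF t \<omega> c = (\<lambda>x. (T_ABDF_1 t \<omega> c x, T_ABDF_2 t \<omega> c x))"

definition T_TASEP ::
  "nat \<Rightarrow> (nat \<times> int \<Rightarrow> int) \<Rightarrow> (int \<Rightarrow> int) \<Rightarrow> int \<Rightarrow> int" where
  "T_TASEP t \<omega> \<eta> =
     (if t = 0 then \<eta>
      else (\<lambda>x. (kappa \<omega> (t - 1, x) * \<eta> x + \<omega> (t - 1, x) * \<eta> (x + 1)) * \<eta> x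
              + (kappa \<omega> (t - 1, x - 1) * \<eta> x + \<omega> (t - 1, x - 1) * \<eta> (x - 1)) * (1 - \<eta> x)))"

definition pair_op_1 :: "(int \<Rightarrow> int) \<Rightarrow> int \<Rightarrow> int" where
  "pair_op_1 \<eta> x = 1 - \<eta> x - \<eta> (x + 1)"

definition pair_op_2 :: "(int \<Rightarrow> int) \<Rightarrow> int \<Rightarrow> int" where
  "pair_op_2 \<eta> = (if pair_op_1 \<eta> \<noteq> (\<lambda>x. 0) then ar (pair_op_1 \<eta>) else \<eta>)"

definition pair_op :: "(int \<Rightarrow> int) \<Rightarrow> int \<Rightarrow> int \<times> int" where
  "pair_op \<eta> x = (pair_op_1 \<eta> x, pair_op_2 \<eta> x)"

end

(* Writing \<theta> for the first component of pair_op \<eta>, one has \<theta> x = 1, -1, 0 according to whether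
   \<eta> has the pattern 00, 11, or one of 01, 10 at (x, x + 1).  Hence \<eta> alternates along any run of
   zeros of \<theta>, and propagating from the nearest nonzero entry shows that the activation record
   marks exactly the pattern 10: the second component is \<eta> x * (1 - \<eta> (x + 1)).  With this local
   formula the intertwining relation is a pointwise identity, and \<eta> is recovered from (\<theta>, act)
   as 1 where \<theta> = -1, 0 where \<theta> = 1, and act where \<theta> = 0. *)
theory Submission
  imports Defs
begin

section \<open>Closed forms of the activation record\<close>

lemma ar_nonzero: "\<theta> x \<in> {-1, 1} \<Longrightarrow> ar \<theta> x = 0"
  by (simp add: ar_def)

text \<open>Half the sum of two signs has absolute value 1 if they agree and is 0 otherwise. Here
  the signs are \<open>\<theta> y\<close> and the parity sign of \<open>x - y\<close>.\<close>

lemma ar_left: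
  assumes "y < x" "\<theta> y \<in> {-1, 1}" "\<And>z. y < z \<Longrightarrow> z \<le> x \<Longrightarrow> \<theta> z = 0"
  shows "ar \<theta> x = of_bool (\<theta> y = 1 \<longleftrightarrow> even (x - y))"
proof -
  have mem: "y \<in> Lset \<theta> x"
    using assms(1,2) by (simp add: Lset_def)
  have G: "(GREATEST z. z \<in> Lset \<theta> x) = y"
  proof (rule Greatest_equality)
    show "y \<in> Lset \<theta> x" by (rule mem)
    fix z assume "z \<in> Lset \<theta> x"
    then show "z \<le> y"
      using assms(3)[of z] by (force simp: Lset_def)
  qed
  have "\<theta> x = 0" using assms by simp
  moreover have "Lset \<theta> x \<noteq> {}" using mem by blast
  ultimately have "ar \<theta> x = \<bar>(\<theta> y + (-1) ^ nat (x - y)) div 2\<bar>"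
    by (simp add: ar_def G Let_def)
  then show ?thesis
    using assms(1,2) by (auto simp: minus_one_power_iff even_nat_iff)
qed

text \<open>The right-hand rule of \<open>ar\<close> is reached only if \<open>Lset\<close> is
  empty, so signs are excluded at every site below \<open>y\<close>, not only between
  \<open>x\<close> and \<open>y\<close>. The extra 1 in the exponent turns \<open>even\<close> into
  \<open>odd\<close>.\<close>

lemma ar_right:
  assumes "x < y" "\<theta> y \<in> {-1, 1}" "\<And>z. z < y \<Longrightarrow> \<theta> z \<notin> {-1, 1}"
  shows "ar \<theta> x = of_bool (\<theta> y = 1 \<longleftrightarrow> odd (y - x))"
proof -
  have mem: "y \<in> Rset \<theta> x"
    using assms(1,2) by (simp add: Rset_def)
  have G: "(LEAST z. z \<in> Rset \<theta> x) = y"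
  proof (rule Least_equality)
    show "y \<in> Rset \<theta> x" by (rule mem)
    fix z assume "z \<in> Rset \<theta> x"
    then show "y \<le> z"
      using assms(3)[of z] by (force simp: Rset_def)
  qed
  have "\<theta> x \<notin> {-1, 1}" using assms by simp
  moreover have "Rset \<theta> x \<noteq> {}" using mem by blast
  moreover have "Lset \<theta> x = {}"
    using assms(1,3) by (fastforce simp: Lset_def)
  ultimately have "ar \<theta> x = \<bar>(\<theta> y + (-1) ^ (nat (y - x) + 1)) div 2\<bar>"
    by (simp add: ar_def G Let_def)
  then show ?thesis
    using assms(1,2) by (auto simp: minus_one_power_iff even_nat_iff)
qed

text \<open>The sites below \<open>x\<close> with property \<open>P\<close> may be infinitely many;
  cutting at the witness \<open>w\<close> leaves a finite set with the same maximum.\<close>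

lemma nearest_below:
  fixes x :: int
  assumes "P w" "w < x"
  obtains y where "y < x" "P y" "\<And>z. y < z \<Longrightarrow> z < x \<Longrightarrow> \<not> P z"
proof -
  let ?S = "{z \<in> {w..<x}. P z}"
  have fin: "finite ?S"
    by (rule finite_subset[of _ "{w..<x}"]) auto
  have "w \<in> ?S" using assms by simp
  then have mem: "Max ?S \<in> ?S" using fin Max_in by blast
  show ?thesis
  proof (rule that[of "Max ?S"])
    show "Max ?S < x" "P (Max ?S)" using mem by auto
    show "\<not> P z" if "Max ?S < z" "z < x" for z
      using that mem Max_ge[OF fin, of z] by auto
  qed
qed

text \<open>Reflection at 0 turns this into \<open>nearest_below\<close>.\<close>

lemma nearest_above:
  fixes x :: int
  assumes "P w" "x < w"
  obtains y where "x < y" "P y" "\<And>z. x < z \<Longrightarrow> z < y \<Longrightarrow> \<not> P z"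
proof -
  obtain y where "y < - x" "P (- y)" "\<And>z. y < z \<Longrightarrow> z < - x \<Longrightarrow> \<not> P (- z)"
    using nearest_below[of "\<lambda>z. P (- z)" "- w" "- x"] assms by auto
  then show ?thesis
    using that[of "- y"] by (metis minus_less_iff neg_less_iff_less minus_minus)
qed

section \<open>Local formula for the pair map\<close>

lemma binary_cases: "\<eta> \<in> binary_seqs \<Longrightarrow> \<eta> x = 0 \<or> \<eta> x = 1"
  by (auto simp: binary_seqs_def)

lemma pair_op_1_ternary: "\<eta> \<in> binary_seqs \<Longrightarrow> pair_op_1 \<eta> \<in> ternary_seqs"
  using binary_cases[of \<eta>]
  by (auto simp: ternary_seqs_def pair_op_1_def) (smt (verit))

text \<open>A zero at \<open>z\<close> forces \<open>\<eta> (z + 1) = 1 - \<eta> z\<close>, one flip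
  per step. Zeros from \<open>a\<close> up to but excluding \<open>b\<close> therefore control
  \<open>\<eta>\<close> up to and including \<open>b\<close>.\<close>

lemma pair_op_1_zero_run:
  assumes "a \<le> b" "\<And>z. a \<le> z \<Longrightarrow> z < b \<Longrightarrow> pair_op_1 \<eta> z = 0"
  shows "\<eta> b = (if even (b - a) then \<eta> a else 1 - \<eta> a)"
  using assms
proof (induction b rule: int_ge_induct)
  case base
  then show ?case by simp
next
  case (step b)
  have "\<eta> (b + 1) = 1 - \<eta> b"
    using step.prems[of b] step.hyps by (simp add: pair_op_1_def)
  then show ?case using step by auto
qed

lemma alternating_eq_alt:
  assumes "\<eta> \<in> binary_seqs" "pair_op_1 \<eta> = (\<lambda>x. 0)"
  shows "\<eta> = (if \<eta> 0 = 1 then alt1 else alt0)"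
proof
  fix x
  \<comment> \<open>For negative \<open>x\<close> the run from \<open>x\<close> to 0 is read
    backwards, a flip being its own inverse.\<close>
  have "\<eta> x = (if even x then \<eta> 0 else 1 - \<eta> 0)"
    using pair_op_1_zero_run[of 0 x \<eta>] pair_op_1_zero_run[of x 0 \<eta>] assms(2)
    by (cases "0 \<le> x") auto
  then show "\<eta> x = (if \<eta> 0 = 1 then alt1 else alt0) x"
    using binary_cases[OF assms(1), of 0]
    by (auto simp: alt0_def alt1_def mod2_eq_if)
qed

lemma ar_pair_op_1:
  assumes \<eta>: "\<eta> \<in> binary_seqs" and nz: "pair_op_1 \<eta> \<noteq> (\<lambda>x. 0)"
  shows "ar (pair_op_1 \<eta>) x = \<eta> x * (1 - \<eta> (x + 1))"
proof -
  let ?\<theta> = "pair_op_1 \<eta>"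
  note bin = binary_cases[OF \<eta>]
  have tern: "?\<theta> z \<in> {-1, 1} \<longleftrightarrow> ?\<theta> z \<noteq> 0" for z
    using pair_op_1_ternary[OF \<eta>] by (auto simp: ternary_seqs_def)
  show ?thesis
  proof (cases "?\<theta> x = 0")
    case False
    then have "ar ?\<theta> x = 0" using ar_nonzero tern by blast
    then show ?thesis
      using False bin[of x] bin[of "x + 1"] by (auto simp: pair_op_1_def)
  next
    case True
    \<comment> \<open>At a zero of \<open>?\<theta>\<close> the target
      \<open>\<eta> x * (1 - \<eta> (x + 1))\<close> is the square of \<open>\<eta> x\<close>, hence
      \<open>\<eta> x\<close> itself.\<close>
    have "ar ?\<theta> x = \<eta> x"
    proof (cases "\<exists>w<x. ?\<theta> w \<noteq> 0")
      case True
      then obtain y where y: "y < x" "?\<theta> y \<noteq> 0" "\<And>z. y < z \<Longrightarrow> z < x \<Longrightarrow> ?\<theta> z = 0"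
        using nearest_below[of "\<lambda>w. ?\<theta> w \<noteq> 0"] by metis
      have "ar ?\<theta> x = of_bool (?\<theta> y = 1 \<longleftrightarrow> even (x - y))"
        using y \<open>?\<theta> x = 0\<close> tern by (intro ar_left) (auto simp: le_less)
      \<comment> \<open>The run starts at \<open>y + 1\<close>: the nonzero entry at
        \<open>y\<close> means \<open>\<eta> y = \<eta> (y + 1)\<close>, and its sign gives this
        common value.\<close>
      moreover have "\<eta> x = (if even (x - (y + 1)) then \<eta> (y + 1) else 1 - \<eta> (y + 1))"
        using y by (intro pair_op_1_zero_run) auto
      ultimately show ?thesis
        using y(2) bin[of y] bin[of "y + 1"] by (auto simp: pair_op_1_def)
    next
      case False
      obtain w where "?\<theta> w \<noteq> 0" using nz by blast
      moreover from this have "x < w"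
        using False \<open>?\<theta> x = 0\<close> by (metis linorder_neqE)
      ultimately obtain y where y: "x < y" "?\<theta> y \<noteq> 0" "\<And>z. x < z \<Longrightarrow> z < y \<Longrightarrow> ?\<theta> z = 0"
        using nearest_above[of "\<lambda>w. ?\<theta> w \<noteq> 0"] by metis
      have zero: "?\<theta> z = 0" if "z < y" for z
        using that False y(3) \<open>?\<theta> x = 0\<close> by (metis linorder_neqE)
      have "ar ?\<theta> x = of_bool (?\<theta> y = 1 \<longleftrightarrow> odd (y - x))"
        using y(1,2) zero tern by (intro ar_right) auto
      moreover have "\<eta> y = (if even (y - x) then \<eta> x else 1 - \<eta> x)"
        using y(1) zero by (intro pair_op_1_zero_run) auto
      ultimately show ?thesis
        using y(2) bin[of x] bin[of y] bin[of "y + 1"]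
        by (auto simp: pair_op_1_def split: if_splits)
    qed
    then show ?thesis
      using True bin[of x] by (auto simp: pair_op_1_def)
  qed
qed

text \<open>One formula covers both branches of \<open>pair_op_2\<close>, so local computations need
  not ask whether \<open>pair_op_1 \<eta>\<close> vanishes. In the alternating branch the product is
  again the square of \<open>\<eta> x\<close>.\<close>

lemma pair_op_2_local:
  assumes "\<eta> \<in> binary_seqs"
  shows "pair_op_2 \<eta> x = \<eta> x * (1 - \<eta> (x + 1))"
proof (cases "pair_op_1 \<eta> = (\<lambda>x. 0)")
  case True
  then have "pair_op_1 \<eta> x = 0" by simp
  then have "\<eta> (x + 1) = 1 - \<eta> x" by (simp add: pair_op_1_def)
  then show ?thesis
    using True binary_cases[OF assms, of x] by (auto simp: pair_op_2_def)
next
  case False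
  then show ?thesis
    using ar_pair_op_1[OF assms False, of x] by (simp add: pair_op_2_def)
qed

section \<open>Pair images lie in \<open>Lambda\<close>\<close>

lemma fst_pair_op: "fst \<circ> pair_op \<eta> = pair_op_1 \<eta>"
  and snd_pair_op: "snd \<circ> pair_op \<eta> = pair_op_2 \<eta>"
  by (auto simp: pair_op_def)

lemma pair_op_1_in_Lambda0:
  assumes \<eta>: "\<eta> \<in> binary_seqs" and nz: "pair_op_1 \<eta> \<noteq> (\<lambda>x. 0)"
  shows "pair_op_1 \<eta> \<in> Lambda0"
proof -
  let ?\<theta> = "pair_op_1 \<eta>"
  note bin = binary_cases[OF \<eta>]
  \<comment> \<open>Both gap conditions at once: the nonzero entries fix
    \<open>\<eta> (x1 + 1)\<close> and \<open>\<eta> x2\<close>, and the run between them makes as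
    many flips as the gap has sites.\<close>
  have gap: "?\<theta> x1 = ?\<theta> x2 \<longleftrightarrow> even (card {x1<..<x2})"
    if "x1 < x2" "\<forall>x\<in>{x1<..<x2}. ?\<theta> x = 0" "?\<theta> x1 \<noteq> 0" "?\<theta> x2 \<noteq> 0" for x1 x2
  proof -
    have "\<eta> x2 = (if even (x2 - (x1 + 1)) then \<eta> (x1 + 1) else 1 - \<eta> (x1 + 1))"
      using that by (intro pair_op_1_zero_run) auto
    moreover have "even (card {x1<..<x2}) \<longleftrightarrow> even (x2 - (x1 + 1))"
      using that(1) by (simp add: even_nat_iff)
    ultimately show ?thesis
      using that(3,4) bin[of x1] bin[of "x1 + 1"] bin[of x2] bin[of "x2 + 1"]
      by (auto simp: pair_op_1_def split: if_splits)
  qed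
  \<comment> \<open>The product -1 excludes equal entries because squares are nonnegative; the
    product 1 forces two equal units of \<int>.\<close>
  have "?\<theta> x1 \<noteq> ?\<theta> x2" "?\<theta> x1 \<noteq> 0" "?\<theta> x2 \<noteq> 0" if "?\<theta> x1 * ?\<theta> x2 = -1" for x1 x2
    using that zero_le_square[of "?\<theta> x2"] by (auto simp del: zero_le_square)
  moreover have "?\<theta> x1 = ?\<theta> x2" "?\<theta> x1 \<noteq> 0" "?\<theta> x2 \<noteq> 0" if "?\<theta> x1 * ?\<theta> x2 = 1" for x1 x2
    using that by (auto simp: zmult_eq_1_iff)
  ultimately show ?thesis
    unfolding Lambda0_def using pair_op_1_ternary[OF \<eta>] nz gap by blast
qed

lemma pair_op_in_Lambda:
  assumes "\<eta> \<in> binary_seqs"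
  shows "pair_op \<eta> \<in> Lambda"
proof -
  have "pair_op \<eta> x \<in> {-1, 0, 1} \<times> {0, 1}" for x
    using pair_op_1_ternary[OF assms] pair_op_2_local[OF assms, of x]
      binary_cases[OF assms, of x] binary_cases[OF assms, of "x + 1"]
    by (auto simp: pair_op_def ternary_seqs_def)
  moreover have "pair_op_2 \<eta> \<in> {alt0, alt1}" if "pair_op_1 \<eta> = (\<lambda>x. 0)"
    using alternating_eq_alt[OF assms that] that
    unfolding pair_op_2_def by (metis insertCI)
  moreover have "pair_op_2 \<eta> = ar (pair_op_1 \<eta>)" if "pair_op_1 \<eta> \<noteq> (\<lambda>x. 0)"
    using that by (simp add: pair_op_2_def)
  ultimately show ?thesis
    using pair_op_1_in_Lambda0[OF assms]
    unfolding Lambda_def mem_Collect_eq fst_pair_op snd_pair_op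
    by (cases "pair_op_1 \<eta> = (\<lambda>x. 0)") (simp_all only: Pi_I simp_thms)
qed

section \<open>Reconstruction of the binary sequence\<close>

definition unpair :: "(int \<Rightarrow> int \<times> int) \<Rightarrow> int \<Rightarrow> int" where
  "unpair c x = (if fst (c x) = -1 then 1 else if fst (c x) = 1 then 0 else snd (c x))"

lemma unpair_pair_op: "\<eta> \<in> binary_seqs \<Longrightarrow> unpair (pair_op \<eta>) = \<eta>"
proof
  fix x assume "\<eta> \<in> binary_seqs"
  then show "unpair (pair_op \<eta>) x = \<eta> x"
    using pair_op_2_local[of \<eta> x] binary_cases[of \<eta> x] binary_cases[of \<eta> "x + 1"]
    by (auto simp: unpair_def pair_op_def pair_op_1_def)
qed

lemma unpair_binary:
  assumes "c \<in> Lambda"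
  shows "unpair c \<in> binary_seqs"
proof -
  have "snd (c x) \<in> {0, 1}" for x
  proof -
    have "c x \<in> {-1, 0, 1} \<times> {0, 1}"
      using assms unfolding Lambda_def by blast
    then show ?thesis by auto
  qed
  then show ?thesis by (auto simp: unpair_def binary_seqs_def)
qed

text \<open>Zeros at both \<open>x\<close> and \<open>x + 1\<close> take their records from the same
  nearest nonzero entry, at distances of opposite parity, so the records are complementary. If one
  of the two entries is nonzero, its sign matches the neighbouring record, by the parity conditions
  when that record is read from the other side.\<close>

lemma unpair_pair_sum_Lambda0:
  assumes L0: "\<theta> \<in> Lambda0"
  shows "1 - unpair (\<lambda>x. (\<theta> x, ar \<theta> x)) x - unpair (\<lambda>x. (\<theta> x, ar \<theta> x)) (x + 1) = \<theta> x"
proof -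
  have tern: "\<theta> z = -1 \<or> \<theta> z = 0 \<or> \<theta> z = 1" for z
    using L0 by (auto simp: Lambda0_def ternary_seqs_def)
  \<comment> \<open>The gap has \<open>x2 - x1 - 1\<close> sites, so its parity is opposite to that
    of the distance.\<close>
  have gap: "\<theta> x1 = \<theta> x2 \<longleftrightarrow> odd (x2 - x1)"
    if "x1 < x2" "\<And>z. x1 < z \<Longrightarrow> z < x2 \<Longrightarrow> \<theta> z = 0" "\<theta> x1 \<noteq> 0" "\<theta> x2 \<noteq> 0" for x1 x2
  proof -
    have "even (card {x1<..<x2}) \<longleftrightarrow> odd (x2 - x1)"
      using that(1) by (simp add: even_nat_iff)
    moreover have "\<theta> x1 * \<theta> x2 = -1 \<Longrightarrow> odd (card {x1<..<x2})"
      "\<theta> x1 * \<theta> x2 = 1 \<Longrightarrow> even (card {x1<..<x2})"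
      using L0 that(1,2) unfolding Lambda0_def by auto
    ultimately show ?thesis
      using tern[of x1] tern[of x2] that(3,4) by auto
  qed
  show ?thesis
  proof (cases "\<theta> x = 0")
    case False
    show ?thesis
    proof (cases "\<theta> (x + 1) = 0")
      case True
      \<comment> \<open>The record is read at the odd distance 1, so it is 1 exactly when
        \<open>\<theta> x = -1\<close>: the reconstructed value at \<open>x\<close> is
        repeated.\<close>
      have "ar \<theta> (x + 1) = of_bool (\<theta> x = 1 \<longleftrightarrow> even (x + 1 - x))"
        using True False tern[of x]
        by (intro ar_left) (auto dest: zless_imp_add1_zle)
      then show ?thesis
        using False True tern[of x] by (auto simp: unpair_def)
    next
      case nz: False
      \<comment> \<open>The gap is empty, hence even, and adjacent signs agree.\<close>
      have "\<theta> x = \<theta> (x + 1)"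
        using gap[of x "x + 1"] False nz by simp
      then show ?thesis
        using False tern[of x] by (auto simp: unpair_def)
    qed
  next
    case zero: True
    show ?thesis
    proof (cases "\<exists>w<x. \<theta> w \<noteq> 0")
      case True
      then obtain y where y: "y < x" "\<theta> y \<noteq> 0" "\<And>z. y < z \<Longrightarrow> z < x \<Longrightarrow> \<theta> z = 0"
        using nearest_below[of "\<lambda>w. \<theta> w \<noteq> 0"] by metis
      have y': "\<theta> y \<in> {-1, 1}" using tern[of y] y(2) by auto
      have run: "\<theta> z = 0" if "y < z" "z \<le> x" for z
        using that y(3) zero by (cases "z = x") auto
      have ar: "ar \<theta> x = of_bool (\<theta> y = 1 \<longleftrightarrow> even (x - y))"
        using y(1) y' run by (rule ar_left)
      show ?thesis
      proof (cases "\<theta> (x + 1) = 0")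
        case True
        have "\<theta> z = 0" if "y < z" "z \<le> x + 1" for z
          using that run[of z] True by (cases "z = x + 1") auto
        then have "ar \<theta> (x + 1) = of_bool (\<theta> y = 1 \<longleftrightarrow> even (x + 1 - y))"
          using y(1) y' by (intro ar_left) auto
        then show ?thesis
          using ar zero True by (auto simp: unpair_def)
      next
        case False
        \<comment> \<open>With this parity the record at \<open>x\<close>, read from
          \<open>y\<close>, is 1 exactly when \<open>\<theta> (x + 1) = 1\<close>, so it complements
          the reconstructed value at \<open>x + 1\<close>.\<close>
        have "\<theta> y = \<theta> (x + 1) \<longleftrightarrow> odd (x + 1 - y)"
          using y(1,2) run False by (intro gap) auto
        then show ?thesis
          using ar zero False tern[of "x + 1"] y' by (auto simp: unpair_def)
      qed
    next
      case False
      obtain w where "\<theta> w \<noteq> 0"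
        using L0 unfolding Lambda0_def by blast
      moreover from this have "x < w"
        using False zero by (metis linorder_neqE)
      ultimately obtain y where y: "x < y" "\<theta> y \<noteq> 0" "\<And>z. x < z \<Longrightarrow> z < y \<Longrightarrow> \<theta> z = 0"
        using nearest_above[of "\<lambda>w. \<theta> w \<noteq> 0"] by metis
      have y': "\<theta> y \<in> {-1, 1}" using tern[of y] y(2) by auto
      have run: "\<theta> z \<notin> {-1, 1}" if "z < y" for z
      proof -
        have "\<theta> z = 0"
          using that False y(3) zero by (metis linorder_neqE)
        then show ?thesis by simp
      qed
      have ar: "ar \<theta> x = of_bool (\<theta> y = 1 \<longleftrightarrow> odd (y - x))"
        using y(1) y' run by (rule ar_right)
      show ?thesis
      proof (cases "y = x + 1")
        case True
        then show ?thesis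
          using ar zero y' by (auto simp: unpair_def)
      next
        case False
        then have "x + 1 < y" using y(1) by simp
        then have "ar \<theta> (x + 1) = of_bool (\<theta> y = 1 \<longleftrightarrow> odd (y - (x + 1)))"
          using y' run by (rule ar_right)
        then show ?thesis
          using ar zero y(3)[of "x + 1"] \<open>x + 1 < y\<close> by (auto simp: unpair_def)
      qed
    qed
  qed
qed

lemma pair_op_unpair:
  assumes c: "c \<in> Lambda"
  shows "pair_op (unpair c) = c"
proof -
  let ?\<theta> = "fst \<circ> c" and ?act = "snd \<circ> c"
  have c_eq: "c = (\<lambda>x. (?\<theta> x, ?act x))" by simp
  consider (zero) "?\<theta> = (\<lambda>x. 0)" "?act \<in> {alt0, alt1}" | (L0) "?\<theta> \<in> Lambda0" "?act = ar ?\<theta>"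
    using c by (auto simp: Lambda_def)
  then show ?thesis
  proof cases
    case zero
    \<comment> \<open>Here \<open>?\<theta>\<close> carries no information; \<open>?act\<close>
      alone decides which alternating sequence is recovered.\<close>
    have "fst (c x) = 0" for x using zero(1) by (metis comp_apply)
    then have u: "unpair c = ?act" by (auto simp: unpair_def)
    have "pair_op_1 ?act = ?\<theta>"
    proof
      fix x
      show "pair_op_1 ?act x = ?\<theta> x"
        using zero by (elim insertE) (auto simp: pair_op_1_def alt0_def alt1_def mod2_eq_if)
    qed
    then have "pair_op_1 (unpair c) = ?\<theta>" "pair_op_2 (unpair c) = ?act"
      unfolding pair_op_2_def u zero(1) by simp_all
    then show ?thesis
      by (simp add: pair_op_def fun_eq_iff)
  next
    case L0
    have c_ar: "c = (\<lambda>x. (?\<theta> x, ar ?\<theta> x))"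
      using c_eq L0(2) by simp
    have p1: "pair_op_1 (unpair c) = ?\<theta>"
    proof
      fix x
      show "pair_op_1 (unpair c) x = ?\<theta> x"
        using unpair_pair_sum_Lambda0[OF L0(1), of x] c_ar by (simp add: pair_op_1_def)
    qed
    moreover have "?\<theta> \<noteq> (\<lambda>x. 0)"
      using L0(1) by (simp add: Lambda0_def)
    ultimately have "pair_op_2 (unpair c) = ar ?\<theta>"
      by (simp add: pair_op_2_def)
    then have "pair_op (unpair c) = (\<lambda>x. (?\<theta> x, ar ?\<theta> x))"
      using p1 by (intro ext) (simp only: pair_op_def)
    then show ?thesis
      using c_ar by (rule trans[OF _ sym])
  qed
qed

section \<open>Intertwining of the two dynamics\<close>

lemma noise_cases: "\<omega> \<in> noise \<Longrightarrow> \<omega> p = 0 \<or> \<omega> p = 1"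
  by (auto simp: noise_def)

lemma T_TASEP_binary:
  assumes "\<eta> \<in> binary_seqs" "\<omega> \<in> noise"
  shows "T_TASEP t \<omega> \<eta> \<in> binary_seqs"
proof -
  have "T_TASEP t \<omega> \<eta> x \<in> {0, 1}" for x
    using binary_cases[OF assms(1), of x] binary_cases[OF assms(1), of "x + 1"]
      binary_cases[OF assms(1), of "x - 1"]
      noise_cases[OF assms(2), of "(t - 1, x)"] noise_cases[OF assms(2), of "(t - 1, x - 1)"]
    by (auto simp: T_TASEP_def kappa_def)
  then show ?thesis by (simp add: binary_seqs_def)
qed

text \<open>By the local formula both sides at \<open>x\<close> involve \<open>\<eta>\<close> only
  on the four sites from \<open>x - 1\<close> to \<open>x + 2\<close>. The noise on the bond from
  \<open>x\<close> to \<open>x + 1\<close> cancels on the TASEP side, since a jump across it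
  preserves the sum of the two values.\<close>

lemma T_ABDF_1_pair_op:
  assumes "\<eta> \<in> binary_seqs"
  shows "T_ABDF_1 t \<omega> (pair_op \<eta>) = pair_op_1 (T_TASEP t \<omega> \<eta>)"
proof (cases "t = 0")
  case True
  then show ?thesis by (simp add: T_ABDF_1_def T_TASEP_def fst_pair_op)
next
  case False
  show ?thesis
  proof
    fix x
    show "T_ABDF_1 t \<omega> (pair_op \<eta>) x = pair_op_1 (T_TASEP t \<omega> \<eta>) x"
      using False binary_cases[OF assms, of "x - 1"] binary_cases[OF assms, of x]
        binary_cases[OF assms, of "x + 1"] binary_cases[OF assms, of "x + 1 + 1"]
      unfolding T_ABDF_1_def Let_def fst_pair_op snd_pair_op T_TASEP_def pair_op_1_def
        pair_op_2_local[OF assms] kappa_def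
      by (elim disjE) (simp_all add: algebra_simps)
  qed
qed

lemma T_ABDF_pair_op:
  assumes \<eta>: "\<eta> \<in> binary_seqs" and \<omega>: "\<omega> \<in> noise"
  shows "T_ABDF t \<omega> (pair_op \<eta>) = pair_op (T_TASEP t \<omega> \<eta>)"
proof -
  let ?\<eta>' = "T_TASEP t \<omega> \<eta>"
  note T1 = T_ABDF_1_pair_op[OF \<eta>, of t \<omega>]
  have "T_ABDF_2 t \<omega> (pair_op \<eta>) = pair_op_2 ?\<eta>'"
  proof (cases "t = 0 \<or> pair_op_1 ?\<eta>' \<noteq> (\<lambda>x. 0)")
    case True
    then show ?thesis
      by (auto simp: T_ABDF_2_def T1 pair_op_2_def T_TASEP_def snd_pair_op)
  next
    case False
    \<comment> \<open>The new pair sequence vanishes, so only the value at 0 remains to be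
      determined.\<close>
    have alt: "?\<eta>' = (if ?\<eta>' 0 = 1 then alt1 else alt0)"
      using False by (intro alternating_eq_alt T_TASEP_binary \<eta> \<omega>) auto
    \<comment> \<open>The three ways to have a particle at 0 after the step: it is blocked by one at
      1, it jumps in from -1, or it is free to leave but stays.\<close>
    have at0: "?\<eta>' 0 = 1 \<longleftrightarrow> pair_op_1 \<eta> 0 = -1
        \<or> (pair_op_2 \<eta> (-1) = 1 \<and> \<omega> (t - 1, -1) = 1)
        \<or> (pair_op_2 \<eta> 0 = 1 \<and> \<omega> (t - 1, 0) = 0)"
      using False binary_cases[OF \<eta>, of "-1"] binary_cases[OF \<eta>, of 0] binary_cases[OF \<eta>, of 1]
        noise_cases[OF \<omega>, of "(t - 1, -1)"] noise_cases[OF \<omega>, of "(t - 1, 0)"]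
      by (auto simp: T_TASEP_def pair_op_1_def pair_op_2_local[OF \<eta>] kappa_def)
    have "T_ABDF_2 t \<omega> (pair_op \<eta>) = (if ?\<eta>' 0 = 1 then alt1 else alt0)"
      unfolding at0 using False by (simp add: T_ABDF_2_def T1 fst_pair_op snd_pair_op Let_def)
    then have "T_ABDF_2 t \<omega> (pair_op \<eta>) = ?\<eta>'"
      by (rule trans) (rule alt[symmetric])
    then show ?thesis
      using False by (simp add: pair_op_2_def)
  qed
  then show ?thesis
    by (simp add: T_ABDF_def T1 pair_op_def fun_eq_iff)
qed

theorem theorem7:
  "bij_betw pair_op binary_seqs Lambda \<and>
   (\<forall>\<eta>\<in>binary_seqs. \<forall>t. \<forall>\<omega>\<in>noise.
      T_ABDF t \<omega> (pair_op \<eta>) = pair_op (T_TASEP t \<omega> \<eta>)) \<and>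
   (\<forall>t. \<forall>\<omega>\<in>noise. T_ABDF t \<omega> ` Lambda \<subseteq> Lambda)"
proof (intro conjI ballI allI)
  show "bij_betw pair_op binary_seqs Lambda"
    by (rule bij_betw_byWitness[where f' = unpair])
      (auto simp: unpair_pair_op pair_op_unpair pair_op_in_Lambda unpair_binary)
  show "T_ABDF t \<omega> (pair_op \<eta>) = pair_op (T_TASEP t \<omega> \<eta>)"
    if "\<eta> \<in> binary_seqs" "\<omega> \<in> noise" for \<eta> t \<omega>
    using that by (rule T_ABDF_pair_op)
  show "T_ABDF t \<omega> ` Lambda \<subseteq> Lambda" if "\<omega> \<in> noise" for t \<omega>
  proof
    fix d assume "d \<in> T_ABDF t \<omega> ` Lambda"
    then obtain c where "c \<in> Lambda" "d = T_ABDF t \<omega> c" by blast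
    \<comment> \<open>Every \<open>c\<close> in \<open>Lambda\<close> is a pair image, so the
      intertwining relation makes its ABDF successor a pair image too.\<close>
    then have "d = pair_op (T_TASEP t \<omega> (unpair c))"
      using T_ABDF_pair_op[OF unpair_binary that] pair_op_unpair by metis
    then show "d \<in> Lambda"
      using \<open>c \<in> Lambda\<close> that by (simp add: pair_op_in_Lambda T_TASEP_binary unpair_binary)
  qed
qed

end
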